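(* Let $S$ be a nonempty set, let $(G,\cdot,d)$ be a complete metric group whose metric $d$ is invariant to left translations, i.e. $d(x\cdot y, x\cdot z)=d(y,z)$ for all $x,y,z\in G$, and let $\varphi:S\to S$ and $g:S\to G$ be given functions. Let $\varepsilon:S\to[0,\infty)$ be a function with the property that $$\sum_{n=0}^\infty \varepsilon(\varphi^n(x))=\Phi(x)\quad\text{for all } x\in S,$$ where $\Phi:S\to[0,\infty)$ (so the series converges for every $x\in S$). Then for every function $f:S\to G$ satisfying $$d\big(f(\varphi(x)),\,g(x)\cdot f(x)\big)\le \varepsilon(x)\quad\text{for all } x\in S,$$ there exists a unique function $f_0:S\to G$ such that $$f_0(\varphi(x))=g(x)\cdot f_0(x)\quad\text{for all } x\in S$$ and $$d(f(x),f_0(x))\le\Phi(x)\quad\text{for all } x\in S.$$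
   Context: A complete metric group $(G,\cdot,d)$ means: $(G,\cdot)$ is a group (not necessarily commutative), $(G,d)$ is a complete metric space, and the group operation $G\times G\to G$ and the inverse operation $G\to G$ are continuous with respect to the product topology on $G\times G$ and the topology generated by $d$ on $G$. For $k\in\mathbb{N}\cup\{0\}$, $\varphi^k$ denotes the $k$-th iterate of $\varphi$: $\varphi^0$ is the identity map of $S$ and $\varphi^k=\varphi\circ\varphi^{k-1}$ for $k\ge 1$. *)

theory Defs
  imports "HOL-Algebra.Group" "HOL-Analysis.Analysis"
begin

locale complete_metric_group = group G + Metric_space "carrier G" d
  for G :: "('a, 'b) monoid_scheme" (structure) and d :: "'a \<Rightarrow> 'a \<Rightarrow> real" +
  assumes complete: mcomplete
    and continuous_mult:
      "continuous_map (prod_topology mtopology mtopology) mtopology (\<lambda>(x, y). x \<otimes> y)"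
    and continuous_inverse: "continuous_map mtopology mtopology (m_inv G)"

end

theory Submission imports Defs begin

text \<open>
  A solution of the cocycle equation satisfies \<open>f\<^sub>0 x = inv (g x) \<otimes> f\<^sub>0 (\<phi> x)\<close>, so it is sought as the
  pointwise limit of \<open>f\<close> under the operator sending \<open>h\<close> to \<open>\<lambda>x. inv (g x) \<otimes> h (\<phi> x)\<close>.
  Left invariance makes consecutive iterates at \<open>x\<close> differ by at most \<open>\<epsilon> (\<phi>\<^sup>n x)\<close>, whence convergence
  and the bound \<open>\<Phi>\<close>. Along an orbit the distance of two solutions is constant, while
  it is at most \<open>2 \<Phi> (\<phi>\<^sup>n x)\<close>, which is twice a tail of a convergent series.
\<close>

lemma (in Metric_space) dist_le_sum_steps:
  assumes "range \<sigma> \<subseteq> M" and "\<And>n. d (\<sigma> n) (\<sigma> (Suc n)) \<le> e n" and "m \<le> n"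
  shows "d (\<sigma> m) (\<sigma> n) \<le> sum e {m..<n}"
  using \<open>m \<le> n\<close>
proof (induction n rule: dec_induct)
  case base
  show ?case using assms(1) by (simp add: range_subsetD)
next
  case (step n)
  have "d (\<sigma> m) (\<sigma> (Suc n)) \<le> d (\<sigma> m) (\<sigma> n) + d (\<sigma> n) (\<sigma> (Suc n))"
    using assms(1) by (intro triangle) auto
  also have "\<dots> \<le> sum e {m..<n} + e n"
    using step.IH assms(2) by (rule add_mono)
  also have "\<dots> = sum e {m..<Suc n}"
    using step.hyps by simp
  finally show ?case .
qed

text \<open>Summable step bounds make the sequence Cauchy, and their full sum bounds the total
  displacement. Taken with the iterates at a fixed point as \<open>\<sigma>\<close>, it yields both
  the value of the solution there and the estimate by \<open>\<Phi>\<close>.\<close>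

lemma (in Metric_space) summable_steps_convergent:
  assumes "mcomplete" and ran: "range \<sigma> \<subseteq> M"
    and steps: "\<And>n. d (\<sigma> n) (\<sigma> (Suc n)) \<le> e n" and "e sums s"
  obtains l where "limitin mtopology \<sigma> l sequentially" and "d (\<sigma> 0) l \<le> s"
proof -
  have e_nonneg: "0 \<le> e n" for n
    using steps[of n] nonneg order_trans by blast
  have "summable e" and s: "suminf e = s"
    using \<open>e sums s\<close> by (auto simp: sums_iff)
  have "MCauchy \<sigma>"
    unfolding MCauchy_def
  proof (intro conjI allI impI ran)
    fix r :: real assume "r > 0"
    then obtain N where N: "\<And>m n. m \<ge> N \<Longrightarrow> norm (sum e {m..<n}) < r"
      using \<open>summable e\<close> unfolding summable_Cauchy by blast
    have ordered: "d (\<sigma> m) (\<sigma> n) < r" if "N \<le> m" "m \<le> n" for m n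
      using dist_le_sum_steps[of \<sigma> e, OF ran steps \<open>m \<le> n\<close>] N[OF \<open>N \<le> m\<close>, of n] by simp
    have "d (\<sigma> m) (\<sigma> n) < r" if "N \<le> m" "N \<le> n" for m n
      using ordered[of m n] ordered[of n m] that commute[of "\<sigma> m" "\<sigma> n"]
      by (cases m n rule: le_cases) auto
    then show "\<exists>N. \<forall>n n'. N \<le> n \<longrightarrow> N \<le> n' \<longrightarrow> d (\<sigma> n) (\<sigma> n') < r"
      by blast
  qed
  then obtain l where l: "limitin mtopology \<sigma> l sequentially"
    using \<open>mcomplete\<close> unfolding mcomplete_def by blast
  have "l \<in> M" using l by (rule limitin_mspace)
  \<comment> \<open>A term within \<open>r\<close> of the limit serves as intermediate point; its
    distance from \<open>\<sigma> 0\<close> is at most a partial sum, hence at most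
    \<open>s\<close>, since the bounds \<open>e\<close> dominate distances and so are
    nonnegative.\<close>
  have "d (\<sigma> 0) l \<le> s + r" if "r > 0" for r
  proof -
    obtain n where n: "d (\<sigma> n) l < r"
      using l \<open>r > 0\<close> unfolding limit_metric_sequentially by blast
    have "d (\<sigma> 0) (\<sigma> n) \<le> sum e {0..<n}"
      using dist_le_sum_steps[of \<sigma> e, OF ran steps] by simp
    also have "\<dots> \<le> s"
      unfolding s[symmetric] using \<open>summable e\<close> e_nonneg by (intro sum_le_suminf) auto
    finally have "d (\<sigma> 0) (\<sigma> n) \<le> s" .
    moreover have "d (\<sigma> 0) l \<le> d (\<sigma> 0) (\<sigma> n) + d (\<sigma> n) l"
      using ran \<open>l \<in> M\<close> by (intro triangle) auto
    ultimately show ?thesis using n by linarith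
  qed
  then have "d (\<sigma> 0) l \<le> s" by (rule field_le_epsilon)
  with l show thesis by (rule that)
qed

text \<open>The tail from \<open>n\<close> on is the total minus the partial sum of the first
  \<open>n\<close> terms, and these partial sums tend to the total.\<close>

lemma sums_shift_tendsto_0:
  fixes e :: "nat \<Rightarrow> 'a::real_normed_vector"
  assumes "e sums s" and "\<And>n. (\<lambda>k. e (k + n)) sums t n"
  shows "t \<longlonglongrightarrow> 0"
proof -
  have "t = (\<lambda>n. s - sum e {..<n})"
    using sums_unique2[OF assms(2) sums_split_initial_segment[OF assms(1)]] by blast
  moreover have "(\<lambda>n. s - sum e {..<n}) \<longlonglongrightarrow> s - s"
    using assms(1) unfolding sums_def by (intro tendsto_diff tendsto_const)
  ultimately show ?thesis by simp
qed

theorem theorem2p2: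
  fixes S :: "'s set"
    and G :: "('a, 'b) monoid_scheme" (structure)
    and d :: "'a \<Rightarrow> 'a \<Rightarrow> real"
    and \<phi> :: "'s \<Rightarrow> 's"
    and g f :: "'s \<Rightarrow> 'a"
    and \<epsilon> \<Phi> :: "'s \<Rightarrow> real"
  assumes "S \<noteq> {}"
    and "complete_metric_group G d"
    and "\<And>x y z. \<lbrakk>x \<in> carrier G; y \<in> carrier G; z \<in> carrier G\<rbrakk>
          \<Longrightarrow> d (x \<otimes> y) (x \<otimes> z) = d y z"
    and "\<phi> \<in> S \<rightarrow> S"
    and "g \<in> S \<rightarrow> carrier G"
    and "\<epsilon> \<in> S \<rightarrow> {0..}"
    and "\<Phi> \<in> S \<rightarrow> {0..}"
    and "\<And>x. x \<in> S \<Longrightarrow> (\<lambda>n. \<epsilon> ((\<phi> ^^ n) x)) sums \<Phi> x"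
    and "f \<in> S \<rightarrow> carrier G"
    and "\<And>x. x \<in> S \<Longrightarrow> d (f (\<phi> x)) (g x \<otimes> f x) \<le> \<epsilon> x"
  shows "\<exists>!f\<^sub>0. f\<^sub>0 \<in> S \<rightarrow>\<^sub>E carrier G \<and>
           (\<forall>x\<in>S. f\<^sub>0 (\<phi> x) = g x \<otimes> f\<^sub>0 x) \<and>
           (\<forall>x\<in>S. d (f x) (f\<^sub>0 x) \<le> \<Phi> x)"
proof -
  interpret complete_metric_group G d by fact
  note invariant = assms(3) and sums_\<Phi> = assms(8) and approx = assms(10)
  have \<phi>: "\<phi> x \<in> S" and g: "g x \<in> carrier G" and f: "f x \<in> carrier G" if "x \<in> S" for x
    using that assms by auto
  have \<phi>_pow: "(\<phi> ^^ n) x \<in> S" if "x \<in> S" for x n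
    using that \<phi> by (induction n) auto

  \<comment> \<open>The recursion runs over functions, because the next iterate at \<open>x\<close>
    uses the previous one at \<open>\<phi> x\<close>.\<close>
  define h where "h = rec_nat f (\<lambda>_ k x. inv (g x) \<otimes> k (\<phi> x))"
  have h_0: "h 0 = f" and h_Suc: "h (Suc n) x = inv (g x) \<otimes> h n (\<phi> x)" for n x
    by (simp_all add: h_def)
  have h_carrier: "h n x \<in> carrier G" if "x \<in> S" for n x
    using that by (induction n arbitrary: x) (simp_all add: h_0 h_Suc f g \<phi>)
  have h_step: "d (h n x) (h (Suc n) x) \<le> \<epsilon> ((\<phi> ^^ n) x)" if "x \<in> S" for n x
    using that
  proof (induction n arbitrary: x)
    case 0
    \<comment> \<open>Translating both points by \<open>g x\<close> turns the first step into the
      hypothesis on \<open>f\<close>.\<close>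
    have "d (f x) (inv (g x) \<otimes> f (\<phi> x)) = d (g x \<otimes> f x) (g x \<otimes> (inv (g x) \<otimes> f (\<phi> x)))"
      using 0 by (simp add: invariant f g \<phi>)
    also have "\<dots> = d (f (\<phi> x)) (g x \<otimes> f x)"
      using 0 by (simp add: f g \<phi> inv_solve_left m_assoc[symmetric] commute)
    finally show ?case using approx[OF 0] by (simp add: h_0 h_Suc)
  next
    case (Suc n)
    \<comment> \<open>Both iterates start with the factor \<open>inv (g x)\<close>, which invariance
      cancels. What remains is the previous step at \<open>\<phi> x\<close>, hence the induction
      over arbitrary \<open>x\<close>.\<close>
    have "d (h (Suc n) x) (h (Suc (Suc n)) x) = d (h n (\<phi> x)) (h (Suc n) (\<phi> x))"
      using Suc.prems by (subst (1 2) h_Suc) (simp add: invariant h_carrier g \<phi>)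
    also have "\<dots> \<le> \<epsilon> ((\<phi> ^^ n) (\<phi> x))"
      using Suc.IH Suc.prems \<phi> by blast
    finally show ?case by (simp add: funpow_swap1)
  qed
  have "\<exists>l. limitin mtopology (\<lambda>n. h n x) l sequentially \<and> d (f x) l \<le> \<Phi> x" if "x \<in> S" for x
  proof (rule summable_steps_convergent[OF complete])
    show "range (\<lambda>n. h n x) \<subseteq> carrier G" using that h_carrier by auto
    show "d (h n x) (h (Suc n) x) \<le> \<epsilon> ((\<phi> ^^ n) x)" for n using that by (rule h_step)
    show "(\<lambda>n. \<epsilon> ((\<phi> ^^ n) x)) sums \<Phi> x" using that by (rule sums_\<Phi>)
  qed (auto simp: h_0)
  then obtain L where L: "\<And>x. x \<in> S \<Longrightarrow> limitin mtopology (\<lambda>n. h n x) (L x) sequentially"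
    and L_dist: "\<And>x. x \<in> S \<Longrightarrow> d (f x) (L x) \<le> \<Phi> x"
    by metis
  have L_carrier: "L x \<in> carrier G" if "x \<in> S" for x
    using L[OF that] by (rule limitin_mspace)
  have L_eq: "L (\<phi> x) = g x \<otimes> L x" if "x \<in> S" for x
  proof -
    \<comment> \<open>Left translation by \<open>inv (g x)\<close> is an isometry on the carrier, so
      it carries the limit at \<open>\<phi> x\<close> along.\<close>
    have "limitin mtopology (\<lambda>n. h (Suc n) x) (inv (g x) \<otimes> L (\<phi> x)) sequentially"
      using L[OF \<phi>[OF that]] that
      by (simp add: limit_metric_sequentially h_Suc h_carrier L_carrier \<phi> g invariant)
    moreover have "limitin mtopology (\<lambda>n. h (Suc n) x) (L x) sequentially"
      using limitin_sequentially_offset[OF L[OF that], of 1] by simp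
    ultimately have "inv (g x) \<otimes> L (\<phi> x) = L x"
      using limitin_metric_unique trivial_limit_sequentially by blast
    then show ?thesis
      using that by (metis L_carrier \<phi> g inv_solve_left)
  qed

  show ?thesis
  \<comment> \<open>\<open>L\<close> is arbitrary outside \<open>S\<close>; restricting it fixes the
    value \<open>undefined\<close> there, so that uniqueness becomes equality of HOL
    functions.\<close>
  proof (rule ex1I[of _ "restrict L S"])
    show "restrict L S \<in> S \<rightarrow>\<^sub>E carrier G \<and>
        (\<forall>x\<in>S. restrict L S (\<phi> x) = g x \<otimes> restrict L S x) \<and>
        (\<forall>x\<in>S. d (f x) (restrict L S x) \<le> \<Phi> x)"
      by (simp add: L_carrier L_eq L_dist \<phi>)
  next
    fix F assume F: "F \<in> S \<rightarrow>\<^sub>E carrier G \<and> (\<forall>x\<in>S. F (\<phi> x) = g x \<otimes> F x) \<and>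
        (\<forall>x\<in>S. d (f x) (F x) \<le> \<Phi> x)"
    then have F_carrier: "F x \<in> carrier G" if "x \<in> S" for x
      using that by auto
    have "F x = L x" if "x \<in> S" for x
    proof -
      \<comment> \<open>Each application of \<open>\<phi>\<close> multiplies both solutions on the
        left by the same value of \<open>g\<close>.\<close>
      have orbit: "d (F ((\<phi> ^^ n) x)) (L ((\<phi> ^^ n) x)) = d (F x) (L x)" for n
        by (induction n) (use F that in \<open>simp_all add: L_eq L_carrier F_carrier \<phi>_pow g invariant\<close>)
      have "d (F x) (L x) \<le> 2 * \<Phi> ((\<phi> ^^ n) x)" for n
      proof -
        let ?y = "(\<phi> ^^ n) x"
        have y: "?y \<in> S" using that by (rule \<phi>_pow)
        have "d (F ?y) (L ?y) \<le> d (f ?y) (F ?y) + d (f ?y) (L ?y)"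
          using y by (simp add: triangle'' f F_carrier L_carrier)
        also have "\<dots> \<le> \<Phi> ?y + \<Phi> ?y"
          using F L_dist[OF y] y by (intro add_mono) auto
        finally show ?thesis by (simp add: orbit)
      qed
      moreover have "(\<lambda>n. 2 * \<Phi> ((\<phi> ^^ n) x)) \<longlonglongrightarrow> 0"
      proof (intro tendsto_mult_right_zero sums_shift_tendsto_0)
        show "(\<lambda>n. \<epsilon> ((\<phi> ^^ n) x)) sums \<Phi> x" using that by (rule sums_\<Phi>)
        \<comment> \<open>The series at \<open>(\<phi> ^^ n) x\<close> is the series at
          \<open>x\<close> without its first \<open>n\<close> terms.\<close>
        show "(\<lambda>k. \<epsilon> ((\<phi> ^^ (k + n)) x)) sums \<Phi> ((\<phi> ^^ n) x)" for n
          using sums_\<Phi>[OF \<phi>_pow[OF that]] by (simp add: funpow_add)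
      qed
      ultimately have "d (F x) (L x) \<le> 0"
        using LIMSEQ_le_const by blast
      then show ?thesis
        using that by (metis F_carrier L_carrier nonneg order_antisym zero)
    qed
    then show "F = restrict L S"
      using F by (auto intro!: extensionalityI[of _ S] simp: PiE_def)
  qed
qed

end
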